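(* Let $[n]=\bigsqcup_{\ell=1}^mS_\ell$ be a partition, let $\pi\in\Delta^{n-1}$ be weights with strictly positive entries, and let $\mu_1^\star,\dots,\mu_m^\star\in\mathbb R^d$. Assume every $S_\ell$ is nonempty. For $\mu=(\mu_1,\dots,\mu_n)\in\mathbb R^{dn}$ let $\widehat\pi_\ell=\sum_{i\in S_\ell}\pi_i$ and $\bar\mu_\ell=\frac1{\widehat\pi_\ell}\sum_{i\in S_\ell}\pi_i\mu_i$. Then for any $\mu\in\mathbb R^{dn}$, $$\sum_{\ell=1}^m\sum_{i\in S_\ell}\pi_i\|\mu_i-\mu_\ell^\star\|^2=B(\mu)+D(\mu),$$ where $B(\mu)=\sum_{\ell=1}^m\widehat\pi_\ell\|\bar\mu_\ell-\mu_\ell^\star\|^2$ and $D(\mu)=\sum_{\ell=1}^m\sum_{i\in S_\ell}\pi_i\|\mu_i-\bar\mu_\ell\|^2$.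
   Context: $\Delta^{n-1}$ is the probability simplex in $\mathbb R^n$, $[n]=\{1,\dots,n\}$, and $\|\cdot\|$ is the Euclidean norm. $B$ is called the cluster bias and $D$ the intra-cluster dispersion. *)

theory Defs
  imports "HOL-Analysis.Analysis"
begin

text \<open>
  Vectors indexed by \<open>[n] = {1..n}\<close> (weights, and tuples \<open>\<mu> = (\<mu>\<^sub>1, \<dots>, \<mu>\<^sub>n)\<close> of points) are
  functions on \<open>nat\<close> of which only the values on \<open>{1..n}\<close> matter; likewise for families indexed by
  \<open>[m] = {1..m}\<close>. A single dimension \<open>d\<close> occurs, as the index type of \<open>real ^ 'd\<close>.
\<close>

definition prob_simplex :: "nat \<Rightarrow> (nat \<Rightarrow> real) set" where
  "prob_simplex n = {p. (\<forall>i\<in>{1..n}. 0 \<le> p i) \<and> (\<Sum>i=1..n. p i) = 1}"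

definition indexed_partition :: "nat \<Rightarrow> nat \<Rightarrow> (nat \<Rightarrow> nat set) \<Rightarrow> bool" where
  "indexed_partition n m S \<longleftrightarrow> (\<Union>l\<in>{1..m}. S l) = {1..n} \<and> disjoint_family_on S {1..m}"

definition cluster_weight :: "(nat \<Rightarrow> nat set) \<Rightarrow> (nat \<Rightarrow> real) \<Rightarrow> nat \<Rightarrow> real" where
  "cluster_weight S \<pi> l = (\<Sum>i\<in>S l. \<pi> i)"

definition cluster_mean ::
  "(nat \<Rightarrow> nat set) \<Rightarrow> (nat \<Rightarrow> real) \<Rightarrow> (nat \<Rightarrow> real ^ 'd) \<Rightarrow> nat \<Rightarrow> real ^ 'd" where
  "cluster_mean S \<pi> \<mu> l = (1 / cluster_weight S \<pi> l) *\<^sub>R (\<Sum>i\<in>S l. \<pi> i *\<^sub>R \<mu> i)"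

definition cluster_bias ::
  "nat \<Rightarrow> (nat \<Rightarrow> nat set) \<Rightarrow> (nat \<Rightarrow> real) \<Rightarrow> (nat \<Rightarrow> real ^ 'd) \<Rightarrow> (nat \<Rightarrow> real ^ 'd) \<Rightarrow> real" where
  "cluster_bias m S \<pi> \<mu>star \<mu> =
     (\<Sum>l=1..m. cluster_weight S \<pi> l * (norm (cluster_mean S \<pi> \<mu> l - \<mu>star l))\<^sup>2)"

definition intra_cluster_dispersion ::
  "nat \<Rightarrow> (nat \<Rightarrow> nat set) \<Rightarrow> (nat \<Rightarrow> real) \<Rightarrow> (nat \<Rightarrow> real ^ 'd) \<Rightarrow> real" where
  "intra_cluster_dispersion m S \<pi> \<mu> =
     (\<Sum>l=1..m. \<Sum>i\<in>S l. \<pi> i * (norm (\<mu> i - cluster_mean S \<pi> \<mu> l))\<^sup>2)"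

end

theory Submission
  imports Defs
begin

text \<open>
  In each cluster, expand around the barycentre; the cross term is the inner product of a fixed
  vector with the weighted sum of the deviations from the barycentre, which vanishes.
\<close>

text \<open>Pulling the constant barycentre out of the sum produces the factor
  \<open>sum w A\<close>, which cancels the normalising reciprocal. The nonzero total also forces
  \<open>A\<close> to be finite, since a sum over an infinite set is 0.\<close>

lemma sum_weighted_deviation_barycenter:
  fixes x :: "'i \<Rightarrow> 'a::real_vector"
  assumes "sum w A \<noteq> 0"
  shows "(\<Sum>i\<in>A. w i *\<^sub>R (x i - (1 / sum w A) *\<^sub>R (\<Sum>j\<in>A. w j *\<^sub>R x j))) = 0"
  using assms
  by (simp add: scaleR_diff_right sum_subtractf flip: scaleR_sum_left sum_divide_distrib)

text \<open>The parallel axis (Huygens-Steiner) identity, to be used on one cluster at a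
  time.\<close>

lemma sum_weighted_norm_sq_barycenter:
  fixes x :: "'i \<Rightarrow> 'a::real_inner" and c :: 'a
  assumes "sum w A \<noteq> 0"
  defines "b \<equiv> (1 / sum w A) *\<^sub>R (\<Sum>i\<in>A. w i *\<^sub>R x i)"
  shows "(\<Sum>i\<in>A. w i * (norm (x i - c))\<^sup>2) =
           sum w A * (norm (b - c))\<^sup>2 + (\<Sum>i\<in>A. w i * (norm (x i - b))\<^sup>2)"
proof -
  \<comment> \<open>Square of \<open>(x i - b) + (b - c)\<close>. The weight sits inside the inner
    product so that summing over \<open>i\<close> acts on the first argument alone.\<close>
  have "w i * (norm (x i - c))\<^sup>2 =
      w i * (norm (b - c))\<^sup>2 + w i * (norm (x i - b))\<^sup>2 + 2 * ((w i *\<^sub>R (x i - b)) \<bullet> (b - c))" for i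
    by (simp add: power2_norm_eq_inner inner_diff_left inner_diff_right inner_commute algebra_simps)
  then have "(\<Sum>i\<in>A. w i * (norm (x i - c))\<^sup>2) =
      sum w A * (norm (b - c))\<^sup>2 + (\<Sum>i\<in>A. w i * (norm (x i - b))\<^sup>2)
        + 2 * ((\<Sum>i\<in>A. w i *\<^sub>R (x i - b)) \<bullet> (b - c))"
    by (simp only: sum.distrib inner_sum_left sum_distrib_left sum_distrib_right)
  also have "(\<Sum>i\<in>A. w i *\<^sub>R (x i - b)) = 0"
    unfolding b_def using assms(1) by (rule sum_weighted_deviation_barycenter)
  finally show ?thesis by simp
qed

theorem corollaryB1:
  fixes n m :: nat
    and S :: "nat \<Rightarrow> nat set"
    and \<pi> :: "nat \<Rightarrow> real"
    and \<mu>star \<mu> :: "nat \<Rightarrow> real ^ 'd"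
  assumes "indexed_partition n m S"
    and "\<And>l. l \<in> {1..m} \<Longrightarrow> S l \<noteq> {}"
    and "\<pi> \<in> prob_simplex n"
    and "\<And>i. i \<in> {1..n} \<Longrightarrow> 0 < \<pi> i"
  shows "(\<Sum>l=1..m. \<Sum>i\<in>S l. \<pi> i * (norm (\<mu> i - \<mu>star l))\<^sup>2) =
           cluster_bias m S \<pi> \<mu>star \<mu> + intra_cluster_dispersion m S \<pi> \<mu>"
proof -
  \<comment> \<open>A cluster is a finite nonempty set of indices with positive weights, so its
    total is positive and the barycentre is a genuine quotient.\<close>
  have weight: "sum \<pi> (S l) \<noteq> 0" if "l \<in> {1..m}" for l
  proof -
    have sub: "S l \<subseteq> {1..n}"
      using assms(1) that unfolding indexed_partition_def by blast
    then have "finite (S l)"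
      by (rule finite_subset) simp
    then have "0 < sum \<pi> (S l)"
      using assms(2)[OF that] sub assms(4) by (intro sum_pos) auto
    then show ?thesis by simp
  qed
  \<comment> \<open>Bias and dispersion are merged into one sum over \<open>l\<close>, so that the
    identity can be checked cluster by cluster with \<open>c\<close> taken as
    \<open>\<mu>star l\<close>.\<close>
  show ?thesis
    unfolding cluster_bias_def intra_cluster_dispersion_def cluster_mean_def cluster_weight_def
      sum.distrib[symmetric]
    by (intro sum.cong refl sum_weighted_norm_sq_barycenter weight)
qed

end
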